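(* Consider the discrete-time switched linear control system $x(t+1)=A_{\sigma(t)}x(t)+B_{\sigma(t)}u(t)$ with $A_1,\dots,A_M\in\mathbb{R}^{n\times n}$, $B_1,\dots,B_M\in\mathbb{R}^{n\times m}$. Let $E_0=\{0\}$ and $E_{k+1}=\bigcap_{j=1}^M A_j^{-1}(E_k+\mathrm{Im}(B_j))$ for $k\ge 0$, and let $p\in\mathbb{N}$ be such that $E_p=E_{p+1}$ (so $E_p$ is the fixed point of the sequence). Then the system is Mode-Dependent Fixed-Time Stabilizable (MDFTS) if and only if $E_p=\mathbb{R}^n$. Moreover, in this case a mode-dependent feedback controller achieving mode-dependent fixed-time stabilization can be chosen linear, and is given by $u(t)=K_{\sigma(t)}x(t)$ with $K_j=U_{p,j}Q_p^{-1}$ for $j\in\{1,\dots,M\}$, where $Q_p$ and $U_{p,j}$ are the matrices defined in the context.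
   Context: Notation: $\mathcal{M}=\{1,\dots,M\}$; $\mathbb{N}$ includes $0$; $\mathcal{S}$ is the set of all switching signals $\sigma:\mathbb{N}\to\mathcal{M}$. For a set $V\subseteq\mathbb{R}^n$ and a matrix $A$, $A^{-1}V=\{y\in\mathbb{R}^n\mid Ay\in V\}$ is the preimage ($A$ need not be invertible); $\mathrm{Im}(B)$ is the column space of $B$. The system is MDFTS if there exist functions $\varphi_1,\dots,\varphi_M:\mathbb{R}^n\to\mathbb{R}^m$ and a time $T\in\mathbb{N}$ such that for all $x_0\in\mathbb{R}^n$ and all $\sigma\in\mathcal{S}$, the solution $\Phi^D_\sigma(t,x_0)$ of the closed loop $x(t+1)=A_{\sigma(t)}x(t)+B_{\sigma(t)}\varphi_{\sigma(t)}(x(t))$, $x(0)=x_0$, satisfies $\Phi^D_\sigma(t,x_0)=0$ for all $t\ge T$. The sequence $E_k$ is a non-decreasing sequence of subspaces which becomes constant after some index $p\le n$. Let $e_k=\dim E_k$ (so $e_0=0$). The matrix $Q_p=[q_1\ \cdots\ q_{e_p}]$ is built by successive basis extension: $q_1,\dots,q_{e_k}$ is a basis of $E_k$ for every $k=1,\dots,p$. For each $k\in\{0,\dots,p-1\}$, each $i$ with $e_k+1\le i\le e_{k+1}$, and each $j\in\mathcal{M}$, choose $u_{i,j}\in\mathbb{R}^m$ with $A_jq_i+B_ju_{i,j}\in E_k$ (such a vector exists by definition of $E_{k+1}$). Set $U_{p,j}=[u_{1,j}\ \cdots\ u_{e_p,j}]\in\mathbb{R}^{m\times e_p}$. *)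

theory Defs
  imports "HOL-Analysis.Analysis" "HOL-Library.Set_Algebras"
begin

text \<open>Modes are the naturals in \<open>{1..M}\<close>; values of the families \<open>A\<close>, \<open>B\<close>, \<open>\<phi>\<close> at other
  naturals are irrelevant.\<close>

definition switching_signals :: "nat \<Rightarrow> (nat \<Rightarrow> nat) set" where
  "switching_signals M = {\<sigma>. \<forall>t. \<sigma> t \<in> {1..M}}"

primrec closed_loop ::
  "(nat \<Rightarrow> real^'n^'n) \<Rightarrow> (nat \<Rightarrow> real^'m^'n) \<Rightarrow> (nat \<Rightarrow> real^'n \<Rightarrow> real^'m) \<Rightarrow>
   (nat \<Rightarrow> nat) \<Rightarrow> real^'n \<Rightarrow> nat \<Rightarrow> real^'n" where
  "closed_loop A B \<phi> \<sigma> x\<^sub>0 0 = x\<^sub>0"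
| "closed_loop A B \<phi> \<sigma> x\<^sub>0 (Suc t) =
     A (\<sigma> t) *v closed_loop A B \<phi> \<sigma> x\<^sub>0 t + B (\<sigma> t) *v \<phi> (\<sigma> t) (closed_loop A B \<phi> \<sigma> x\<^sub>0 t)"

definition achieves_MDFTS ::
  "nat \<Rightarrow> (nat \<Rightarrow> real^'n^'n) \<Rightarrow> (nat \<Rightarrow> real^'m^'n) \<Rightarrow> (nat \<Rightarrow> real^'n \<Rightarrow> real^'m) \<Rightarrow> bool" where
  "achieves_MDFTS M A B \<phi> \<longleftrightarrow>
     (\<exists>T. \<forall>x\<^sub>0. \<forall>\<sigma>\<in>switching_signals M. \<forall>t\<ge>T. closed_loop A B \<phi> \<sigma> x\<^sub>0 t = 0)"

definition MDFTS :: "nat \<Rightarrow> (nat \<Rightarrow> real^'n^'n) \<Rightarrow> (nat \<Rightarrow> real^'m^'n) \<Rightarrow> bool" where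
  "MDFTS M A B \<longleftrightarrow> (\<exists>\<phi>. achieves_MDFTS M A B \<phi>)"

primrec E :: "nat \<Rightarrow> (nat \<Rightarrow> real^'n^'n) \<Rightarrow> (nat \<Rightarrow> real^'m^'n) \<Rightarrow> nat \<Rightarrow> (real^'n) set" where
  "E M A B 0 = {0}"
| "E M A B (Suc k) = (\<Inter>j\<in>{1..M}. (*v) (A j) -` (E M A B k + range ((*v) (B j))))"

definition adapted_basis ::
  "nat \<Rightarrow> (nat \<Rightarrow> real^'n^'n) \<Rightarrow> (nat \<Rightarrow> real^'m^'n) \<Rightarrow> nat \<Rightarrow> (nat \<Rightarrow> real^'n) \<Rightarrow> bool" where
  "adapted_basis M A B p q \<longleftrightarrow>
     (\<forall>k\<in>{1..p}. inj_on q {1..dim (E M A B k)} \<and>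
        independent (q ` {1..dim (E M A B k)}) \<and>
        span (q ` {1..dim (E M A B k)}) = E M A B k)"

definition adapted_inputs ::
  "nat \<Rightarrow> (nat \<Rightarrow> real^'n^'n) \<Rightarrow> (nat \<Rightarrow> real^'m^'n) \<Rightarrow> nat \<Rightarrow>
   (nat \<Rightarrow> real^'n) \<Rightarrow> (nat \<Rightarrow> nat \<Rightarrow> real^'m) \<Rightarrow> bool" where
  "adapted_inputs M A B p q u \<longleftrightarrow>
     (\<forall>k\<in>{0..<p}. \<forall>i\<in>{dim (E M A B k) + 1..dim (E M A B (Suc k))}. \<forall>j\<in>{1..M}.
        A j *v q i + B j *v u i j \<in> E M A B k)"

text \<open>The matrix with columns \<open>v 1, \<dots>, v CARD('n)\<close>. Since matrix columns are indexed by the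
  (unordered) type \<open>'n\<close>, a numbering \<open>idx\<close>, i.e. a bijection from \<open>'n\<close> onto \<open>{1..CARD('n)}\<close>,
  says which vector is put in which column.\<close>

definition matrix_of_columns :: "('n \<Rightarrow> nat) \<Rightarrow> (nat \<Rightarrow> real^'d) \<Rightarrow> real^'n^'d" where
  "matrix_of_columns idx v = (\<chi> r c. v (idx c) $ r)"

end

theory Submission imports Defs begin

text \<open>Let \<open>S\<^sub>k\<close> be the set of states that the closed loop steers to the origin in exactly \<open>k\<close>
  steps under every switching signal. Prepending a mode to a signal shows
  \<open>A\<^sub>j x + B\<^sub>j \<phi>\<^sub>j(x) \<in> S\<^sub>k\<close> for all \<open>x \<in> S\<^sub>k\<^sub>+\<^sub>1\<close> and all \<open>j\<close>, whence \<open>S\<^sub>k \<subseteq> E\<^sub>k\<close> by induction, for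
  arbitrary (nonlinear) feedbacks. Conversely, on an adapted basis the gain satisfies
  \<open>K\<^sub>j q\<^sub>i = u\<^sub>i\<^sub>,\<^sub>j\<close>, so each closed-loop matrix \<open>A\<^sub>j + B\<^sub>j K\<^sub>j\<close> maps \<open>E\<^sub>k\<^sub>+\<^sub>1\<close> into \<open>E\<^sub>k\<close>, and all products of
  \<open>p\<close> of them vanish on \<open>E\<^sub>p\<close>.\<close>

section \<open>The increasing sequence of subspaces\<close>

text \<open>Replacing \<open>v\<close> by \<open>- v\<close> moves the image part across the
  equation. This reads the recursion as steering in one step, in each mode by its own input.\<close>

lemma E_Suc_iff:
  "x \<in> E M A B (Suc k) \<longleftrightarrow> (\<forall>j\<in>{1..M}. \<exists>v. A j *v x + B j *v v \<in> E M A B k)"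
proof -
  have "A j *v x \<in> E M A B k + range ((*v) (B j)) \<longleftrightarrow> (\<exists>v. A j *v x + B j *v v \<in> E M A B k)" for j
  proof
    assume "A j *v x \<in> E M A B k + range ((*v) (B j))"
    then obtain a v where "a \<in> E M A B k" "A j *v x = a + B j *v v"
      by (auto elim: set_plus_elim)
    then have "A j *v x + B j *v (- v) \<in> E M A B k"
      by (simp add: linear_neg[OF matrix_vector_mul_linear])
    then show "\<exists>v. A j *v x + B j *v v \<in> E M A B k" ..
  next
    assume "\<exists>v. A j *v x + B j *v v \<in> E M A B k"
    then obtain v where "A j *v x + B j *v v \<in> E M A B k" ..
    then have "(A j *v x + B j *v v) + B j *v (- v) \<in> E M A B k + range ((*v) (B j))"
      by (intro set_plus_intro) auto
    then show "A j *v x \<in> E M A B k + range ((*v) (B j))"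
      by (simp add: linear_neg[OF matrix_vector_mul_linear])
  qed
  then show ?thesis by auto
qed

lemma subspace_E: "subspace (E M A B k)"
proof (induction k)
  case 0
  show ?case by simp
next
  case (Suc k)
  have "subspace ((*v) (A j) -` (E M A B k + range ((*v) (B j))))" for j
  proof -
    have "subspace (range ((*v) (B j)))"
      by (intro linear_subspace_image matrix_vector_mul_linear subspace_UNIV)
    \<comment> \<open>Translates the set sum into the comprehension in which
      \<open>subspace_sums\<close> is stated.\<close>
    moreover have "S + T = {x + y |x y. x \<in> S \<and> y \<in> T}" for S T :: "(real^'a) set"
      by (auto simp: set_plus_def)
    ultimately have "subspace (E M A B k + range ((*v) (B j)))"
      using subspace_sums[OF Suc] by metis
    then show ?thesis
      by (intro linear_subspace_vimage matrix_vector_mul_linear)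
  qed
  then show ?case by (auto intro!: subspace_Inter)
qed

lemma E_subset_Suc: "E M A B k \<subseteq> E M A B (Suc k)"
proof (induction k)
  case 0
  show ?case using subspace_0[OF subspace_E] by (simp del: E.simps(2))
next
  case (Suc k)
  then show ?case
    by (metis (no_types) E_Suc_iff subset_iff)
qed

lemma E_mono: "k \<le> l \<Longrightarrow> E M A B k \<subseteq> E M A B l"
  by (rule lift_Suc_mono_le) (rule E_subset_Suc)

text \<open>Each term is determined by its predecessor, so one repetition makes the sequence
  constant from \<open>p\<close> on; \<open>k \<le> p + k\<close> then covers every
  \<open>k\<close>.\<close>

lemma E_fixed_point:
  assumes "E M A B p = E M A B (p + 1)"
  shows "E M A B k \<subseteq> E M A B p"
proof -
  have "E M A B (p + d) = E M A B p" for d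
  proof (induction d)
    case (Suc d)
    then have "E M A B (Suc (p + d)) = E M A B (Suc p)"
      by (simp only: E.simps(2))
    then show ?case using assms by (simp del: E.simps)
  qed simp
  then show ?thesis
    by (metis E_mono le_add2)
qed

section \<open>Necessity: states steered to the origin\<close>

lemma closed_loop_case_nat:
  "closed_loop A B \<phi> (case_nat j \<sigma>) x (Suc k) = closed_loop A B \<phi> \<sigma> (A j *v x + B j *v \<phi> j x) k"
  by (induction k) auto

text \<open>Since the signal may start with any mode \<open>j\<close>, the successor of
  \<open>x\<close> under \<open>j\<close> must itself reach the origin in \<open>k\<close> steps;
  thus \<open>\<phi> j x\<close> is the input that the recursion asks for.\<close>

lemma deadbeat_states_subset_E:
  assumes "\<forall>\<sigma>\<in>switching_signals M. closed_loop A B \<phi> \<sigma> x k = 0"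
    and "\<sigma>\<^sub>0 \<in> switching_signals M"
  shows "x \<in> E M A B k"
  using assms(1)
proof (induction k arbitrary: x)
  case 0
  \<comment> \<open>Some signal must exist for the hypothesis to yield \<open>x = 0\<close>;
    \<open>\<sigma>\<^sub>0\<close> provides it.\<close>
  then show ?case using assms(2) by auto
next
  case (Suc k)
  have "A j *v x + B j *v \<phi> j x \<in> E M A B k" if "j \<in> {1..M}" for j
  proof (rule Suc.IH, rule ballI)
    fix \<sigma> assume "\<sigma> \<in> switching_signals M"
    with that have "case_nat j \<sigma> \<in> switching_signals M"
      by (auto simp: switching_signals_def split: nat.split)
    with Suc.prems show "closed_loop A B \<phi> \<sigma> (A j *v x + B j *v \<phi> j x) k = 0"
      by (metis closed_loop_case_nat)
  qed
  then show ?case unfolding E_Suc_iff by blast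
qed

section \<open>Existence of adapted bases and inputs\<close>

text \<open>The old vectors keep their indices and the added ones, \<open>D - C\<close>, are
  numbered after them by a cardinality count; this lets nested bases share one sequence.\<close>

lemma extend_basis_enumeration:
  fixes q :: "nat \<Rightarrow> 'a::euclidean_space"
  assumes sub: "subspace V" "subspace W" "V \<subseteq> W"
    and q: "inj_on q {1..dim V}" "independent (q ` {1..dim V})" "span (q ` {1..dim V}) = V"
  obtains r where "\<And>i. i \<in> {1..dim V} \<Longrightarrow> r i = q i" "inj_on r {1..dim W}"
    "independent (r ` {1..dim W})" "span (r ` {1..dim W}) = W"
proof -
  define C where "C = q ` {1..dim V}"
  have "C \<subseteq> W"
    using q(3) span_superset[of C] sub(3) unfolding C_def by blast
  then obtain D where D: "C \<subseteq> D" "D \<subseteq> W" "independent D" "W \<subseteq> span D"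
    using maximal_independent_subset_extend[of C W] q(2) unfolding C_def by blast
  have spanD: "span D = W"
    using D sub(2) by (simp add: span_minimal subset_antisym)
  have finD: "finite D" using D(3) by (rule independent_imp_finite)
  have cardD: "card D = dim W" using D by (metis basis_card_eq_dim)
  have cardC: "card C = dim V" unfolding C_def using q(1) by (simp add: card_image)
  have "card (D - C) = card {dim V + 1..dim W}"
    using D(1) cardC cardD by (simp add: card_Diff_subset C_def)
  then obtain h where h: "bij_betw h {dim V + 1..dim W} (D - C)"
    using finD by (metis finite_same_card_bij finite_atLeastAtMost finite_Diff)
  define r where "r i = (if i \<le> dim V then q i else h i)" for i
  have "bij_betw q {1..dim V} C" using q(1) by (simp add: C_def bij_betw_def)
  then have 1: "bij_betw r {1..dim V} C"
    by (rule bij_betw_cong[THEN iffD1, rotated]) (simp add: r_def)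
  have 2: "bij_betw r {dim V + 1..dim W} (D - C)"
    using h by (rule bij_betw_cong[THEN iffD1, rotated]) (simp add: r_def)
  have "{1..dim V} \<union> {dim V + 1..dim W} = {1..dim W}"
    using dim_subset[OF sub(3)] by auto
  then have "bij_betw r {1..dim W} D"
    using bij_betw_combine[OF 1 2] D(1) by (simp add: Un_absorb1)
  then show thesis
    using that[of r] D(3) spanD by (simp add: bij_betw_def r_def)
qed

lemma adapted_basis_exists: "\<exists>q. adapted_basis M A B p q"
proof (induction p)
  case 0
  show ?case by (simp add: adapted_basis_def)
next
  case (Suc p)
  then obtain q where q: "adapted_basis M A B p q" ..
  \<comment> \<open>\<open>adapted_basis\<close> constrains only positive indices; at
    \<open>p = 0\<close> the empty family spans \<open>{0}\<close>.\<close>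
  have "inj_on q {1..dim (E M A B p)} \<and> independent (q ` {1..dim (E M A B p)}) \<and>
      span (q ` {1..dim (E M A B p)}) = E M A B p"
    using q by (cases p) (auto simp: adapted_basis_def independent_empty simp del: E.simps(2))
  then obtain r where r: "\<And>i. i \<in> {1..dim (E M A B p)} \<Longrightarrow> r i = q i"
    "inj_on r {1..dim (E M A B (Suc p))}" "independent (r ` {1..dim (E M A B (Suc p))})"
    "span (r ` {1..dim (E M A B (Suc p))}) = E M A B (Suc p)"
    using extend_basis_enumeration[OF subspace_E subspace_E E_subset_Suc] by metis
  have "adapted_basis M A B (Suc p) r"
    unfolding adapted_basis_def
  proof
    fix k assume k: "k \<in> {1..Suc p}"
    show "inj_on r {1..dim (E M A B k)} \<and> independent (r ` {1..dim (E M A B k)}) \<and>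
        span (r ` {1..dim (E M A B k)}) = E M A B k"
    proof (cases "k = Suc p")
      case True
      then show ?thesis using r(2-) by simp
    next
      case False
      then have "k \<in> {1..p}" using k by auto
      then have "dim (E M A B k) \<le> dim (E M A B p)"
        by (intro dim_subset E_mono) simp
      then have eq: "r i = q i" if "i \<in> {1..dim (E M A B k)}" for i
        using that by (intro r(1)) auto
      have "r ` {1..dim (E M A B k)} = q ` {1..dim (E M A B k)}"
        by (rule image_cong[OF refl eq])
      moreover have "inj_on r {1..dim (E M A B k)} \<longleftrightarrow> inj_on q {1..dim (E M A B k)}"
        by (rule inj_on_cong[OF eq])
      ultimately show ?thesis
        using q \<open>k \<in> {1..p}\<close> unfolding adapted_basis_def by simp
    qed
  qed
  then show ?case by (rule exI[where x = r])
qed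

lemma adapted_basis_mem:
  assumes "adapted_basis M A B p q" "k \<in> {1..p}" "i \<in> {1..dim (E M A B k)}"
  shows "q i \<in> E M A B k"
  using assms span_base[of "q i" "q ` {1..dim (E M A B k)}"] unfolding adapted_basis_def by blast

text \<open>The index blocks between consecutive dimensions are disjoint, so each pair
  \<open>i\<close>, \<open>j\<close> faces at most one requirement.\<close>

lemma adapted_inputs_exist:
  assumes "adapted_basis M A B p q"
  shows "\<exists>u. adapted_inputs M A B p q u"
proof -
  \<comment> \<open>\<open>v\<close> is quantified before \<open>k\<close>, so that choice gives an
    input depending on \<open>i\<close> and \<open>j\<close> only.\<close>
  have "\<exists>v. \<forall>k\<in>{0..<p}. i \<in> {dim (E M A B k) + 1..dim (E M A B (Suc k))} \<longrightarrow>
      j \<in> {1..M} \<longrightarrow> A j *v q i + B j *v v \<in> E M A B k" for i j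
  proof (cases "j \<in> {1..M} \<and> (\<exists>k<p. i \<in> {dim (E M A B k) + 1..dim (E M A B (Suc k))})")
    case True
    then obtain k where k: "k < p" "i \<in> {dim (E M A B k) + 1..dim (E M A B (Suc k))}"
      and j: "j \<in> {1..M}" by blast
    have "q i \<in> E M A B (Suc k)"
      using k by (intro adapted_basis_mem[OF assms]) auto
    then obtain v where v: "A j *v q i + B j *v v \<in> E M A B k"
      using j E_Suc_iff by blast
    have "l = k" if "i \<in> {dim (E M A B l) + 1..dim (E M A B (Suc l))}" for l
    proof (rule ccontr)
      assume "l \<noteq> k"
      then consider "Suc l \<le> k" | "Suc k \<le> l" by linarith
      then show False
        using k(2) that dim_subset[OF E_mono[of "Suc l" k M A B]]
          dim_subset[OF E_mono[of "Suc k" l M A B]] by cases (auto simp del: E.simps)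
    qed
    with v show ?thesis by blast
  next
    case False
    then show ?thesis by auto
  qed
  then obtain u where "\<forall>i j. \<forall>k\<in>{0..<p}. i \<in> {dim (E M A B k) + 1..dim (E M A B (Suc k))} \<longrightarrow>
      j \<in> {1..M} \<longrightarrow> A j *v q i + B j *v u i j \<in> E M A B k"
    by metis
  then show ?thesis unfolding adapted_inputs_def by blast
qed

section \<open>The feedback gain on basis vectors\<close>

lemma matrix_of_columns_mult_axis:
  "matrix_of_columns idx v *v axis c 1 = v (idx c)"
  by (simp add: matrix_of_columns_def matrix_vector_mult_basis column_def vec_eq_iff)

lemma invertible_matrix_of_columns:
  fixes v :: "nat \<Rightarrow> real^'n" and idx :: "'n \<Rightarrow> nat"
  assumes "bij_betw idx UNIV {1..CARD('n)}" "span (v ` {1..CARD('n)}) = UNIV"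
  shows "invertible (matrix_of_columns idx v)"
proof -
  have "columns (matrix_of_columns idx v) = v ` idx ` UNIV"
    by (auto simp: columns_def column_def matrix_of_columns_def vec_lambda_eta)
  then have "span (columns (matrix_of_columns idx v)) = UNIV"
    using assms by (simp add: bij_betw_def)
  then show ?thesis
    using matrix_right_invertible_span_columns[of "matrix_of_columns idx v"]
    by (auto simp: invertible_right_inverse span_vec_eq)
qed

text \<open>The inverse sends column \<open>c\<close> back to the unit vector
  \<open>axis c 1\<close>, which the other factor sends to its own column \<open>c\<close>.\<close>

lemma gain_on_column:
  fixes w :: "nat \<Rightarrow> real^'m" and v :: "nat \<Rightarrow> real^'n" and idx :: "'n \<Rightarrow> nat"
  assumes "invertible (matrix_of_columns idx v)"
  shows "(matrix_of_columns idx w ** matrix_inv (matrix_of_columns idx v)) *v v (idx c) = w (idx c)"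
proof -
  let ?V = "matrix_of_columns idx v"
  have "matrix_inv ?V *v v (idx c) = (matrix_inv ?V ** ?V) *v axis c 1"
    by (simp add: matrix_of_columns_mult_axis flip: matrix_vector_mul_assoc)
  also have "\<dots> = axis c 1"
    using assms unfolding invertible_def matrix_inv_def by (rule someI2_ex) simp
  finally show ?thesis
    by (simp add: matrix_of_columns_mult_axis flip: matrix_vector_mul_assoc)
qed

section \<open>Sufficiency: the linear closed loop\<close>

text \<open>By linearity it suffices to check the basis vectors \<open>q i\<close>. One from block
  \<open>l \<le> k\<close> lands in the \<open>l\<close>-th subspace, which lies in the
  \<open>k\<close>-th.\<close>

lemma closed_loop_matrix_lowers_E:
  assumes q: "adapted_basis M A B p q" and u: "adapted_inputs M A B p q u"
    and K: "\<And>i. i \<in> {1..dim (E M A B p)} \<Longrightarrow> K *v q i = u i j"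
    and j: "j \<in> {1..M}" and k: "k < p" and x: "x \<in> E M A B (Suc k)"
  shows "A j *v x + B j *v (K *v x) \<in> E M A B k"
proof -
  let ?S = "{y. A j *v y + B j *v (K *v y) \<in> E M A B k}"
  have lin: "linear (\<lambda>y. A j *v y + B j *v (K *v y))"
    by (intro linear_compose_add matrix_vector_mul_linear
        linear_compose[OF matrix_vector_mul_linear matrix_vector_mul_linear, unfolded o_def])
  have "subspace ?S"
    using linear_subspace_vimage[OF lin subspace_E] by (simp add: vimage_def)
  moreover have "q ` {1..dim (E M A B (Suc k))} \<subseteq> ?S"
  proof clarify
    fix i assume i: "i \<in> {1..dim (E M A B (Suc k))}"
    \<comment> \<open>The block containing \<open>i\<close>: minimality puts \<open>i\<close> above
      the dimension of the \<open>l\<close>-th subspace, and for \<open>l = 0\<close> that dimension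
      is 0.\<close>
    define l where "l = (LEAST l. i \<le> dim (E M A B (Suc l)))"
    have l: "i \<le> dim (E M A B (Suc l))" "l \<le> k"
      unfolding l_def using i by (auto intro: LeastI Least_le simp del: E.simps)
    have "dim (E M A B l) < i"
    proof (cases l)
      case 0
      then show ?thesis using i by simp
    next
      case (Suc l')
      then show ?thesis
        using not_less_Least[of l' "\<lambda>l. i \<le> dim (E M A B (Suc l))"] l_def
        by (auto simp del: E.simps)
    qed
    then have "A j *v q i + B j *v u i j \<in> E M A B l"
      using u l j k unfolding adapted_inputs_def by auto
    moreover have "K *v q i = u i j"
      using i k dim_subset[OF E_mono[of "Suc k" p M A B]]
      by (intro K) (auto simp del: E.simps)
    ultimately show "A j *v q i + B j *v (K *v q i) \<in> E M A B k"
      using E_mono[OF l(2)] by auto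
  qed
  ultimately have "span (q ` {1..dim (E M A B (Suc k))}) \<subseteq> ?S"
    by (intro span_minimal)
  moreover have "span (q ` {1..dim (E M A B (Suc k))}) = E M A B (Suc k)"
    using q k unfolding adapted_basis_def by (simp del: E.simps)
  ultimately show ?thesis using x by blast
qed

text \<open>The state descends one subspace per step, so \<open>p\<close> serves as the settling
  time; truncated subtraction keeps the invariant valid for \<open>t \<ge> p\<close>.\<close>

lemma adapted_gain_achieves_MDFTS:
  assumes q: "adapted_basis M A B p q" and u: "adapted_inputs M A B p q u"
    and K: "\<And>i j. i \<in> {1..dim (E M A B p)} \<Longrightarrow> K j *v q i = u i j"
    and full: "E M A B p = UNIV"
  shows "achieves_MDFTS M A B (\<lambda>j x. K j *v x)"
proof -
  have "closed_loop A B (\<lambda>j x. K j *v x) \<sigma> x t \<in> E M A B (p - t)"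
    if \<sigma>: "\<sigma> \<in> switching_signals M" for \<sigma> x t
  proof (induction t)
    case 0
    then show ?case using full by simp
  next
    case (Suc t)
    show ?case
    proof (cases "t < p")
      case True
      have "\<sigma> t \<in> {1..M}"
        using \<sigma> by (simp add: switching_signals_def)
      then show ?thesis
        using closed_loop_matrix_lowers_E[OF q u K, of "\<sigma> t" "p - Suc t"] Suc True
        by (simp add: Suc_diff_Suc del: E.simps)
    next
      \<comment> \<open>Here the state is already 0, and a linear feedback keeps it there.\<close>
      case False
      then show ?thesis using Suc by simp
    qed
  qed
  then show ?thesis
    unfolding achieves_MDFTS_def
    by (metis E.simps(1) diff_is_0_eq singletonD)
qed

text \<open>The existence of \<open>q\<close> and \<open>u\<close> keeps the universal claim about
  the gains from being vacuous. Every numbering \<open>idx\<close> works because \<open>Q\<close>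
  and \<open>U\<close> use the same one.\<close>

theorem theorem1:
  fixes M p :: nat
    and A :: "nat \<Rightarrow> real^'n^'n"
    and B :: "nat \<Rightarrow> real^'m^'n"
  assumes "M \<ge> 1"
    and "E M A B p = E M A B (p + 1)"
  shows "(MDFTS M A B \<longleftrightarrow> E M A B p = UNIV) \<and>
    (E M A B p = UNIV \<longrightarrow>
      (\<exists>q u. adapted_basis M A B p q \<and> adapted_inputs M A B p q u) \<and>
      (\<forall>q u (idx :: 'n \<Rightarrow> nat).
         adapted_basis M A B p q \<and> adapted_inputs M A B p q u \<and>
         bij_betw idx UNIV {1..CARD('n)} \<longrightarrow>
           (let Q = matrix_of_columns idx q;
                U = (\<lambda>j. matrix_of_columns idx (\<lambda>i. u i j));
                K = (\<lambda>j. U j ** matrix_inv Q)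
            in invertible Q \<and> achieves_MDFTS M A B (\<lambda>j x. K j *v x))))"
proof -
  have linear_controller: "invertible (matrix_of_columns idx q) \<and>
      achieves_MDFTS M A B (\<lambda>j x. (matrix_of_columns idx (\<lambda>i. u i j) **
        matrix_inv (matrix_of_columns idx q)) *v x)"
    if full: "E M A B p = UNIV" and q: "adapted_basis M A B p q"
      and u: "adapted_inputs M A B p q u" and idx: "bij_betw idx UNIV {1..CARD('n)}"
    for q u and idx :: "'n \<Rightarrow> nat"
  proof
    \<comment> \<open>\<open>adapted_basis\<close> gives a basis at index \<open>p\<close> only for
      positive \<open>p\<close>; \<open>p = 0\<close> would make the whole space, of positive
      dimension, equal to \<open>{0}\<close>.\<close>
    have "p \<noteq> 0"
    proof
      assume "p = 0"
      then have "(UNIV :: (real^'n) set) = {0}" using full by simp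
      then have "dim (UNIV :: (real^'n) set) = dim {0 :: real^'n}" by simp
      then show False by (simp del: dim_eq_0)
    qed
    then have "span (q ` {1..dim (E M A B p)}) = E M A B p"
      using q unfolding adapted_basis_def by (simp del: E.simps)
    then have "span (q ` {1..CARD('n)}) = UNIV"
      by (simp add: full)
    then show inv: "invertible (matrix_of_columns idx q)"
      by (rule invertible_matrix_of_columns[OF idx])
    show "achieves_MDFTS M A B (\<lambda>j x. (matrix_of_columns idx (\<lambda>i. u i j) **
        matrix_inv (matrix_of_columns idx q)) *v x)"
    proof (rule adapted_gain_achieves_MDFTS[OF q u _ full])
      fix i j assume "i \<in> {1..dim (E M A B p)}"
      \<comment> \<open>Fullness makes the basis indices exactly the column numbers.\<close>
      then have "i \<in> range idx"
        using idx full by (simp add: bij_betw_def)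
      then obtain c where "i = idx c" ..
      then show "(matrix_of_columns idx (\<lambda>i. u i j) ** matrix_inv (matrix_of_columns idx q)) *v q i
          = u i j"
        using gain_on_column[OF inv] by simp
    qed
  qed
  have adapted: "\<exists>q u. adapted_basis M A B p q \<and> adapted_inputs M A B p q u"
    using adapted_basis_exists adapted_inputs_exist by blast
  have "E M A B p = UNIV" if stabilizable: "MDFTS M A B"
  proof -
    obtain \<phi> where "achieves_MDFTS M A B \<phi>"
      using stabilizable unfolding MDFTS_def ..
    then obtain T where
      "\<forall>x. \<forall>\<sigma>\<in>switching_signals M. \<forall>t\<ge>T. closed_loop A B \<phi> \<sigma> x t = 0"
      unfolding achieves_MDFTS_def ..
    then have "\<forall>\<sigma>\<in>switching_signals M. closed_loop A B \<phi> \<sigma> x T = 0" for x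
      by simp
    moreover have "(\<lambda>_. 1) \<in> switching_signals M"
      using assms(1) by (simp add: switching_signals_def)
    ultimately have "x \<in> E M A B T" for x
      by (rule deadbeat_states_subset_E)
    then show ?thesis using E_fixed_point[OF assms(2)] by blast
  qed
  moreover have "MDFTS M A B" if "E M A B p = UNIV"
  proof -
    \<comment> \<open>\<open>MDFTS\<close> mentions no numbering, so an arbitrary one is fixed to
      build the gains.\<close>
    obtain idx :: "'n \<Rightarrow> nat" where "bij_betw idx UNIV {1..CARD('n)}"
      using finite_same_card_bij[of "UNIV :: 'n set" "{1..CARD('n)}"] by auto
    then show ?thesis
      using adapted linear_controller[OF that] unfolding MDFTS_def by blast
  qed
  ultimately show ?thesis
    unfolding Let_def using adapted linear_controller by blast
qed

end
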